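(* Let $\mathcal{P}=\{x\in\mathbb{R}^n:\langle a_i,x\rangle\le b_i\ \forall i\in[m]\}$ be a polytope with $m$ facet inequalities. Then for every $x_0\in\mathcal{P}$ and $w\in\mathbb{R}^n$, the total number of breakpoints of the projections curve $g(\lambda)=\Pi_{\mathcal{P}}(x_0-\lambda w)$, $\lambda\ge0$, is $O(2^m)$.
   Context: $\Pi_{\mathcal{P}}$ is Euclidean projection onto $\mathcal{P}$. The curve $g$ is continuous and piecewise affine in $\lambda$; its breakpoints are the successive end points of the maximal $\lambda$-intervals on which $g$ is affine and non-constant. The $O(\cdot)$ constant is absolute. *)

theory Defs
  imports
    "HOL-Analysis.Analysis"
    "Jordan_Normal_Form.Matrix"
begin

text \<open>
  \<open>\<real>\<^sup>n\<close> is the carrier \<^term>\<open>carrier_vec n\<close> rather than a type \<open>real ^ 'n\<close>, because the constant hidden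
  in the \<open>O\<close> has to be chosen before the dimension. Names are qualified and the clashing infixes
  avoided, since HOL-Analysis also has a type \<open>vec\<close> and an infix dot.
\<close>

definition eucl_norm :: "real Matrix.vec \<Rightarrow> real" where
  "eucl_norm x = sqrt (scalar_prod x x)"

definition polyhedron_of ::
    "nat \<Rightarrow> nat \<Rightarrow> (nat \<Rightarrow> real Matrix.vec) \<Rightarrow> (nat \<Rightarrow> real) \<Rightarrow> real Matrix.vec set" where
  "polyhedron_of n m a b = {x \<in> carrier_vec n. \<forall>i<m. scalar_prod (a i) x \<le> b i}"

definition bounded_vecs :: "real Matrix.vec set \<Rightarrow> bool" where
  "bounded_vecs P \<longleftrightarrow> (\<exists>B. \<forall>x\<in>P. eucl_norm x \<le> B)"

definition is_polytope_of ::
    "nat \<Rightarrow> nat \<Rightarrow> (nat \<Rightarrow> real Matrix.vec) \<Rightarrow> (nat \<Rightarrow> real) \<Rightarrow> real Matrix.vec set \<Rightarrow> bool" where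
  "is_polytope_of n m a b P \<longleftrightarrow>
     (\<forall>i<m. a i \<in> carrier_vec n) \<and> P = polyhedron_of n m a b \<and> bounded_vecs P"

definition proj :: "real Matrix.vec set \<Rightarrow> real Matrix.vec \<Rightarrow> real Matrix.vec" where
  "proj P u = (ARG_MIN (\<lambda>y. eucl_norm (u - y)) y. y \<in> P)"

definition proj_curve ::
    "real Matrix.vec set \<Rightarrow> real Matrix.vec \<Rightarrow> real Matrix.vec \<Rightarrow> real \<Rightarrow> real Matrix.vec" where
  "proj_curve P x0 w l = proj P (x0 - smult_vec l w)"

definition affine_on :: "nat \<Rightarrow> (real \<Rightarrow> real Matrix.vec) \<Rightarrow> real set \<Rightarrow> bool" where
  "affine_on n g J \<longleftrightarrow>
     (\<exists>p\<in>carrier_vec n. \<exists>q\<in>carrier_vec n. \<forall>l\<in>J. g l = p + smult_vec l q)"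

definition moving_interval :: "nat \<Rightarrow> (real \<Rightarrow> real Matrix.vec) \<Rightarrow> real set \<Rightarrow> bool" where
  "moving_interval n g J \<longleftrightarrow>
     is_interval J \<and> J \<subseteq> {0..} \<and> affine_on n g J \<and> \<not> g constant_on J"

definition maximal_moving_interval :: "nat \<Rightarrow> (real \<Rightarrow> real Matrix.vec) \<Rightarrow> real set \<Rightarrow> bool" where
  "maximal_moving_interval n g J \<longleftrightarrow>
     moving_interval n g J \<and> (\<forall>J'. moving_interval n g J' \<and> J \<subseteq> J' \<longrightarrow> J' = J)"

text \<open>
  The frontier of an interval in \<open>\<real>\<close> is the set of its finite end points. Both ends count: \<open>g\<close> may
  rest at a point between two moving intervals, and \<open>0\<close> is included if \<open>g\<close> moves from the start.
\<close>

definition breakpoints :: "nat \<Rightarrow> (real \<Rightarrow> real Matrix.vec) \<Rightarrow> real set" where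
  "breakpoints n g = (\<Union>J\<in>{J. maximal_moving_interval n g J}. frontier J)"

end

theory Submission
  imports Defs
begin

text \<open>
  Write \<open>g l\<close> for the point of the curve at the parameter \<open>l\<close>, and classify the parameters
  \<open>l \<ge> 0\<close> by the set \<open>S\<close> of constraints that are tight at \<open>g l\<close>. There are at most \<open>2 ^ m\<close>
  classes. The point of the proof is that each class is an interval and that \<open>g\<close> is affine on the
  segments inside it, so that the relative interior of a face, once left, is never visited again.

  The reason is the characterization of the projection by normal cones: \<open>y \<in> P\<close> is the projection
  of \<open>u\<close> iff \<open>u - y\<close> lies in the normal cone of \<open>P\<close> at \<open>y\<close> (\<open>proj_eq_iff_normal\<close>). The normal
  cone at \<open>y\<close> depends only on the constraints tight at \<open>y\<close> (\<open>normal_cone_mono_active_set\<close>), and it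
  is convex. If \<open>u\<close> and \<open>u'\<close> project to points with the same tight constraints, then a convex
  combination of these points again has the same tight constraints, hence the same normal cone, and
  therefore is the projection of the corresponding convex combination of \<open>u\<close> and \<open>u'\<close>
  (\<open>proj_convex_comb\<close>). Apply this to two points of the ray \<open>x0 - l w\<close>.

  A parameter in the interior of a class has a neighbourhood on which \<open>g\<close> is affine. It cannot be an
  end point of a maximal moving interval, because such an interval could be extended beyond it
  (\<open>maximal_moving_interval_no_interior_break\<close>). So every breakpoint is an end point of a
  class, and an interval has at most two end points: there are at most \<open>2 * 2 ^ m\<close> breakpoints.
\<close>

section \<open>Nearest points of a polytope\<close>

lemma vec_eq_add_smult_diff:
  fixes y z :: "real Matrix.vec"
  assumes "y \<in> carrier_vec n" "z \<in> carrier_vec n"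
  shows "y + smult_vec t (z - y) = smult_vec (1 - t) y + smult_vec t z"
  using assms by (intro eq_vecI) (auto simp: algebra_simps)

lemma scalar_prod_self_nonneg: "0 \<le> scalar_prod x (x :: real Matrix.vec)"
  unfolding scalar_prod_def by (intro sum_nonneg) auto

lemma scalar_prod_self_line:
  fixes x d :: "real Matrix.vec"
  assumes "x \<in> carrier_vec n" "d \<in> carrier_vec n"
  shows "scalar_prod (x - smult_vec t d) (x - smult_vec t d) =
    scalar_prod x x - 2 * t * scalar_prod x d + t\<^sup>2 * scalar_prod d d"
proof -
  have "(\<Sum>i<n. (vec_index x i - t * vec_index d i)\<^sup>2) =
     (\<Sum>i<n. (vec_index x i)\<^sup>2) - 2 * t * (\<Sum>i<n. vec_index x i * vec_index d i)
       + t\<^sup>2 * (\<Sum>i<n. (vec_index d i)\<^sup>2)"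
    by (simp add: power2_diff sum.distrib sum_subtractf sum_distrib_left power_mult_distrib mult_ac)
  then show ?thesis
    using assms by (simp add: scalar_prod_def power2_eq_square atLeast0LessThan)
qed

lemma eucl_norm_le_iff: "eucl_norm x \<le> eucl_norm y \<longleftrightarrow> scalar_prod x x \<le> scalar_prod y y"
  by (simp add: eucl_norm_def)

lemma abs_vec_index_le_eucl_norm:
  assumes "i < dim_vec x"
  shows "\<bar>vec_index x i\<bar> \<le> eucl_norm x"
proof -
  have "(vec_index x i)\<^sup>2 \<le> (\<Sum>j\<in>{0..<dim_vec x}. (vec_index x j)\<^sup>2)"
    using assms by (intro member_le_sum) auto
  then have "sqrt ((vec_index x i)\<^sup>2) \<le> eucl_norm x"
    unfolding eucl_norm_def scalar_prod_def power2_eq_square[symmetric] by (rule real_sqrt_le_mono)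
  then show ?thesis by simp
qed

lemma scalar_prod_add_smult:
  fixes y d :: "real Matrix.vec"
  assumes "v \<in> carrier_vec n" "y \<in> carrier_vec n" "d \<in> carrier_vec n"
  shows "scalar_prod v (y + smult_vec t d) = scalar_prod v y + t * scalar_prod v d"
  using assms by (simp add: scalar_prod_add_distrib[of _ n])

lemma scalar_prod_convex_comb:
  fixes y z :: "real Matrix.vec"
  assumes "v \<in> carrier_vec n" "y \<in> carrier_vec n" "z \<in> carrier_vec n"
  shows "scalar_prod v (smult_vec (1 - t) y + smult_vec t z) =
    (1 - t) * scalar_prod v y + t * scalar_prod v z"
  using assms by (simp add: scalar_prod_add_distrib[of _ n])

lemma polytope_convex:
  assumes "is_polytope_of n m a b P" "y \<in> P" "z \<in> P" "0 \<le> t" "t \<le> 1"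
  shows "smult_vec (1 - t) y + smult_vec t z \<in> P"
proof -
  have P: "\<And>i. i < m \<Longrightarrow> a i \<in> carrier_vec n" "P = polyhedron_of n m a b"
    using assms(1) by (auto simp: is_polytope_of_def)
  have yz: "y \<in> carrier_vec n" "z \<in> carrier_vec n"
    using assms(2,3) P by (auto simp: polyhedron_of_def)
  have "(1 - t) * scalar_prod (a i) y + t * scalar_prod (a i) z \<le> b i" if "i < m" for i
    using assms(2-5) P(2) that by (intro convex_bound_le) (auto simp: polyhedron_of_def)
  then show ?thesis
    using P yz by (auto simp: polyhedron_of_def scalar_prod_convex_comb[of _ n])
qed

text \<open>
  The polytope, with vectors extended by zeros to functions on all of \<open>nat\<close>, is a compact set in the
  product topology: a closed subset of a product of compact intervals. The squared distance from
  \<open>u\<close> is continuous there and attains its minimum.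
\<close>

lemma nearest_point_exists:
  assumes poly: "is_polytope_of n m a b P" and "P \<noteq> {}" and u: "u \<in> carrier_vec n"
  shows "\<exists>y\<in>P. \<forall>z\<in>P. eucl_norm (u - y) \<le> eucl_norm (u - z)"
proof -
  have a: "\<And>i. i < m \<Longrightarrow> a i \<in> carrier_vec n" and P: "P = polyhedron_of n m a b"
    using poly by (auto simp: is_polytope_of_def)
  obtain B where B: "\<And>x. x \<in> P \<Longrightarrow> eucl_norm x \<le> B"
    using poly by (auto simp: is_polytope_of_def bounded_vecs_def)
  \<comment> \<open>\<open>K\<close> is a box containing the extended polytope \<open>Q\<close>, and \<open>F\<close> is the squared distance from \<open>u\<close>.\<close>
  define K where "K = (\<Pi>\<^sub>E i\<in>(UNIV::nat set). if i < n then {-B..B} else {0::real})"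
  define Q where "Q = K \<inter> (\<Inter>i<m. {f. (\<Sum>j<n. vec_index (a i) j * f j) \<le> b i})"
  define F where "F f = (\<Sum>j<n. (vec_index u j - f j)\<^sup>2)" for f :: "nat \<Rightarrow> real"
  have coord: "continuous_on UNIV (\<lambda>f::nat \<Rightarrow> real. f j)" for j
    by (rule continuous_on_product_coordinates)
  have "compactin (product_topology (\<lambda>i. euclidean) UNIV) K"
    unfolding K_def by (subst compactin_PiE) auto
  then have "compact K"
    by (simp add: euclidean_product_topology)
  moreover have "closed (\<Inter>i<m. {f. (\<Sum>j<n. vec_index (a i) j * f j) \<le> b i})"
    by (intro closed_INT ballI closed_Collect_le continuous_intros coord)
  ultimately have "compact Q"
    unfolding Q_def by (rule compact_Int_closed)
  moreover have mem_Q: "(\<lambda>j. if j < n then vec_index z j else 0) \<in> Q" if "z \<in> P" for z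
  proof -
    have z: "z \<in> carrier_vec n" "\<And>i. i < m \<Longrightarrow> scalar_prod (a i) z \<le> b i"
      using that P by (auto simp: polyhedron_of_def)
    have "\<bar>vec_index z j\<bar> \<le> B" if "j < n" for j
      using abs_vec_index_le_eucl_norm[of j z] B[OF \<open>z \<in> P\<close>] z that by auto
    then show ?thesis
      using z by (auto simp: Q_def K_def scalar_prod_def atLeast0LessThan abs_le_iff minus_le_iff)
  qed
  moreover have "continuous_on Q F"
    unfolding F_def by (intro continuous_intros continuous_on_subset[OF coord]) auto
  ultimately obtain f where f: "f \<in> Q" "\<And>h. h \<in> Q \<Longrightarrow> F f \<le> F h"
    using continuous_attains_inf[of Q F] \<open>P \<noteq> {}\<close> by blast
  have "Matrix.vec n f \<in> P"
    using f(1) a P by (auto simp: polyhedron_of_def Q_def scalar_prod_def atLeast0LessThan)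
  moreover have "eucl_norm (u - Matrix.vec n f) \<le> eucl_norm (u - z)" if "z \<in> P" for z
  proof -
    have "z \<in> carrier_vec n"
      using that P by (auto simp: polyhedron_of_def)
    then show ?thesis
      using f(2)[OF mem_Q[OF that]] u
      by (simp add: eucl_norm_le_iff F_def scalar_prod_def atLeast0LessThan power2_eq_square)
  qed
  ultimately show ?thesis by blast
qed

lemma
  assumes poly: "is_polytope_of n m a b P" and u: "u \<in> carrier_vec n" and ne: "P \<noteq> {}"
  shows proj_mem: "proj P u \<in> P"
    and proj_nearest: "z \<in> P \<Longrightarrow> eucl_norm (u - proj P u) \<le> eucl_norm (u - z)"
proof -
  have "\<exists>x. is_arg_min (\<lambda>y. eucl_norm (u - y)) (\<lambda>y. y \<in> P) x"
    using nearest_point_exists[OF poly ne u] by (fastforce simp: is_arg_min_linorder)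
  then have "is_arg_min (\<lambda>y. eucl_norm (u - y)) (\<lambda>y. y \<in> P) (proj P u)"
    unfolding proj_def arg_min_def by (rule someI_ex)
  then show "proj P u \<in> P" "z \<in> P \<Longrightarrow> eucl_norm (u - proj P u) \<le> eucl_norm (u - z)"
    by (auto simp: is_arg_min_linorder)
qed

section \<open>Normal cones\<close>

definition normal_cone :: "real Matrix.vec set \<Rightarrow> real Matrix.vec \<Rightarrow> real Matrix.vec set" where
  "normal_cone P y = {v \<in> carrier_vec (dim_vec y). \<forall>z\<in>P. scalar_prod v (z - y) \<le> 0}"

text \<open>
  Along the segment from \<open>y\<close> to \<open>z\<close> the squared distance from \<open>u\<close> is a quadratic polynomial in the
  segment parameter, whose derivative at \<open>y\<close> is \<open>- 2\<close> times the scalar product of \<open>u - y\<close> and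
  \<open>z - y\<close>. If \<open>y\<close> is nearest to \<open>u\<close>, this derivative cannot be negative. Conversely, if it is
  nonnegative, then moving to \<open>z\<close> increases the squared distance by at least the squared distance of
  \<open>y\<close> and \<open>z\<close>, so \<open>y\<close> is the only nearest point.
\<close>

lemma proj_eq_iff_normal:
  assumes poly: "is_polytope_of n m a b P" and u: "u \<in> carrier_vec n" and y: "y \<in> P"
  shows "proj P u = y \<longleftrightarrow> u - y \<in> normal_cone P y"
proof -
  have PC: "P \<subseteq> carrier_vec n"
    using poly by (auto simp: is_polytope_of_def polyhedron_of_def)
  have expand: "scalar_prod (u - (x + smult_vec t (z - x))) (u - (x + smult_vec t (z - x))) =
      scalar_prod (u - x) (u - x) - 2 * t * scalar_prod (u - x) (z - x)
        + t\<^sup>2 * scalar_prod (z - x) (z - x)" if "x \<in> P" "z \<in> P" for x z t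
  proof -
    have c: "x \<in> carrier_vec n" "z \<in> carrier_vec n" using that PC by auto
    then have "u - (x + smult_vec t (z - x)) = (u - x) - smult_vec t (z - x)"
      using u by (intro eq_vecI) (auto simp: algebra_simps)
    then show ?thesis
      using scalar_prod_self_line[of "u - x" n "z - x" t] c u by simp
  qed
  have "P \<noteq> {}" using y by auto
  note prP = proj_mem[OF poly u this]
    and min = proj_nearest[OF poly u this, unfolded eucl_norm_le_iff]
  show ?thesis
  proof
    assume eq: "proj P u = y"
    have "scalar_prod (u - y) (z - y) \<le> 0" if z: "z \<in> P" for z
    proof (rule ccontr)
      define c D where "c = scalar_prod (u - y) (z - y)" and "D = scalar_prod (z - y) (z - y)"
      assume "\<not> scalar_prod (u - y) (z - y) \<le> 0"
      then have c: "c > 0" and D: "D \<ge> 0"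
        by (auto simp: c_def D_def scalar_prod_self_nonneg)
      \<comment> \<open>Moving by \<open>t\<close> towards \<open>z\<close> changes the squared distance by \<open>t (t D - 2 c)\<close>, so any
        \<open>t\<close> in \<open>(0, 1]\<close> with \<open>t D < 2 c\<close> contradicts minimality; this choice avoids
        a case distinction on \<open>D = 0\<close>.\<close>
      define t where "t = c / (c + D)"
      have t: "0 < t" "t \<le> 1" "t * (c + D) = c" using c D by (auto simp: t_def)
      have "y + smult_vec t (z - y) \<in> P"
        using polytope_convex[OF poly y z, of t] t y z PC
        by (subst vec_eq_add_smult_diff[of _ n]) auto
      from min[OF this] have "2 * t * c \<le> t\<^sup>2 * D"
        using expand[OF y z, of t] eq by (simp add: c_def D_def)
      then have "2 * c \<le> t * D"
        using t by (simp add: power2_eq_square mult.assoc mult.left_commute[of 2])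
      then have "c + t * c \<le> 0" using t(3) by (simp add: algebra_simps)
      moreover have "0 < t * c" using t(1) c by simp
      ultimately show False using c by linarith
    qed
    then show "u - y \<in> normal_cone P y"
      using u y PC by (auto simp: normal_cone_def)
  next
    assume N: "u - y \<in> normal_cone P y"
    let ?z = "proj P u"
    have c: "y \<in> carrier_vec n" "?z \<in> carrier_vec n" using y prP PC by auto
    have "y + smult_vec 1 (?z - y) = ?z"
      using c by (intro eq_vecI) auto
    then have "scalar_prod (?z - y) (?z - y) \<le> 0"
      using expand[OF y prP, of 1] min[OF y] N prP by (auto simp: normal_cone_def)
    then have "(\<Sum>i<n. (vec_index ?z i - vec_index y i)\<^sup>2) \<le> 0"
      using c by (simp add: scalar_prod_def atLeast0LessThan power2_eq_square)
    then have "(\<Sum>i<n. (vec_index ?z i - vec_index y i)\<^sup>2) = 0"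
      by (intro antisym sum_nonneg) auto
    then show "?z = y"
      using c by (intro eq_vecI) (auto simp: sum_nonneg_eq_0_iff)
  qed
qed

definition active_set ::
    "nat \<Rightarrow> (nat \<Rightarrow> real Matrix.vec) \<Rightarrow> (nat \<Rightarrow> real) \<Rightarrow> real Matrix.vec \<Rightarrow> nat set" where
  "active_set m a b y = {i. i < m \<and> scalar_prod (a i) y = b i}"

lemma inactive_slack:
  assumes "is_polytope_of n m a b P" "y \<in> P" "i < m" "i \<notin> active_set m a b y"
  shows "scalar_prod (a i) y < b i"
proof -
  have "scalar_prod (a i) y \<le> b i"
    using assms(1-3) by (auto simp: is_polytope_of_def polyhedron_of_def)
  moreover have "scalar_prod (a i) y \<noteq> b i"
    using assms(3,4) by (simp add: active_set_def)
  ultimately show ?thesis by simp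
qed

text \<open>
  The polytope near \<open>y\<close> is cut out by the constraints tight at \<open>y\<close> alone. For \<open>z \<in> P\<close> the direction
  \<open>z - y'\<close> does not increase the constraints tight at \<open>y'\<close>, in particular not those tight at \<open>y\<close>;
  so a small step from \<open>y\<close> in this direction stays in \<open>P\<close>, and a normal vector at \<open>y\<close> has a nonpositive
  scalar product with it.
\<close>

lemma normal_cone_mono_active_set:
  assumes poly: "is_polytope_of n m a b P" and y: "y \<in> P" "y' \<in> P"
    and act: "active_set m a b y \<subseteq> active_set m a b y'"
  shows "normal_cone P y \<subseteq> normal_cone P y'"
proof
  fix v assume v: "v \<in> normal_cone P y"
  have a: "\<And>i. i < m \<Longrightarrow> a i \<in> carrier_vec n" and P: "P = polyhedron_of n m a b"
    using poly by (auto simp: is_polytope_of_def)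
  have c: "y \<in> carrier_vec n" "y' \<in> carrier_vec n"
    using y P by (auto simp: polyhedron_of_def)
  have "scalar_prod v (z - y') \<le> 0" if z: "z \<in> P" for z
  proof -
    have zc: "z \<in> carrier_vec n" using z P by (auto simp: polyhedron_of_def)
    have "\<forall>\<^sub>F e in at_right 0. \<forall>i\<in>{..<m}.
        scalar_prod (a i) y + e * scalar_prod (a i) (z - y') \<le> b i"
    proof (intro eventually_ball_finite ballI)
      fix i assume "i \<in> {..<m}"
      then have i: "i < m" by simp
      let ?s = "scalar_prod (a i) (z - y')"
      show "\<forall>\<^sub>F e in at_right 0. scalar_prod (a i) y + e * ?s \<le> b i"
      proof (cases "i \<in> active_set m a b y")
        case True
        then have "scalar_prod (a i) y = b i" "scalar_prod (a i) y' = b i"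
          using act by (auto simp: active_set_def)
        moreover have "scalar_prod (a i) z \<le> b i"
          using z i P by (auto simp: polyhedron_of_def)
        ultimately have "?s \<le> 0" "scalar_prod (a i) y = b i"
          using a[OF i] zc c by (simp_all add: scalar_prod_minus_distrib[of _ n])
        then show ?thesis
          using eventually_at_right_less[of "0::real"]
          by (auto elim!: eventually_mono simp: mult_nonneg_nonpos)
      next
        case False
        then have "scalar_prod (a i) y < b i"
          by (rule inactive_slack[OF poly y(1) i])
        moreover have "((\<lambda>e. scalar_prod (a i) y + e * ?s) \<longlongrightarrow> scalar_prod (a i) y + 0 * ?s) (at_right 0)"
          by (intro tendsto_intros)
        ultimately have "\<forall>\<^sub>F e in at_right 0. scalar_prod (a i) y + e * ?s < b i"
          by (intro order_tendstoD(2)) auto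
        then show ?thesis by (rule eventually_mono) simp
      qed
    qed simp
    then have "\<forall>\<^sub>F e in at_right (0::real). 0 < e \<and> (\<forall>i<m.
        scalar_prod (a i) y + e * scalar_prod (a i) (z - y') \<le> b i)"
      using eventually_at_right_less[of "0::real"] by eventually_elim auto
    then obtain e :: real where e: "0 < e" "\<And>i. i < m \<Longrightarrow>
        scalar_prod (a i) y + e * scalar_prod (a i) (z - y') \<le> b i"
      using eventually_happens'[OF trivial_limit_at_right_real] by blast
    have "y + smult_vec e (z - y') \<in> P"
      unfolding P polyhedron_of_def using e(2) a c zc
      by (auto simp: scalar_prod_add_smult[of _ n])
    then have "scalar_prod v (y + smult_vec e (z - y') - y) \<le> 0"
      using v by (auto simp: normal_cone_def)
    moreover have "y + smult_vec e (z - y') - y = smult_vec e (z - y')"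
      using c zc by (intro eq_vecI) auto
    moreover have "v \<in> carrier_vec n"
      using v c by (auto simp: normal_cone_def)
    ultimately have "e * scalar_prod v (z - y') \<le> 0"
      using c zc by simp
    then show ?thesis using e(1) by (simp add: mult_le_0_iff)
  qed
  then show "v \<in> normal_cone P y'"
    using v c by (auto simp: normal_cone_def)
qed

lemma normal_cone_convex_comb:
  assumes "v \<in> normal_cone P y" "v' \<in> normal_cone P y" "0 \<le> t" "t \<le> 1"
    and P: "P \<subseteq> carrier_vec n" "y \<in> carrier_vec n"
  shows "smult_vec (1 - t) v + smult_vec t v' \<in> normal_cone P y"
proof -
  have "scalar_prod (smult_vec (1 - t) v + smult_vec t v') (z - y) =
      (1 - t) * scalar_prod v (z - y) + t * scalar_prod v' (z - y)" if "z \<in> P" for z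
    using assms that by (subst add_scalar_prod_distrib[of _ n]) (auto simp: normal_cone_def)
  moreover have "(1 - t) * scalar_prod v (z - y) + t * scalar_prod v' (z - y) \<le> 0" if "z \<in> P" for z
    using assms that by (intro convex_bound_le) (auto simp: normal_cone_def)
  ultimately show ?thesis
    using assms by (auto simp: normal_cone_def)
qed

text \<open>
  This is the step that makes the number of pieces depend on the number of tight sets only. All three
  points, the two projections and their convex combination, lie in the relative interior of the same
  face and share one normal cone, which contains both residuals \<open>u - proj P u\<close> and
  \<open>u' - proj P u'\<close> and hence their convex combination.
\<close>

lemma proj_convex_comb:
  assumes poly: "is_polytope_of n m a b P" and ne: "P \<noteq> {}"
    and u: "u \<in> carrier_vec n" "u' \<in> carrier_vec n"
    and act: "active_set m a b (proj P u) = S" "active_set m a b (proj P u') = S"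
    and t: "0 \<le> t" "t \<le> 1"
  shows "proj P (smult_vec (1 - t) u + smult_vec t u') =
      smult_vec (1 - t) (proj P u) + smult_vec t (proj P u')" (is ?eq)
    and "active_set m a b (proj P (smult_vec (1 - t) u + smult_vec t u')) = S"
proof -
  let ?y = "proj P u" and ?y' = "proj P u'"
  let ?z = "smult_vec (1 - t) ?y + smult_vec t ?y'"
  have a: "\<And>i. i < m \<Longrightarrow> a i \<in> carrier_vec n" and P: "P = polyhedron_of n m a b"
    using poly by (auto simp: is_polytope_of_def)
  have PC: "P \<subseteq> carrier_vec n"
    using P by (auto simp: polyhedron_of_def)
  note y = proj_mem[OF poly u(1) ne] proj_mem[OF poly u(2) ne]
  have yc: "?y \<in> carrier_vec n" "?y' \<in> carrier_vec n" using y PC by auto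
  have z: "?z \<in> P" by (rule polytope_convex[OF poly y t])
  have tight: "(1 - t) * scalar_prod (a i) ?y + t * scalar_prod (a i) ?y' = b i \<longleftrightarrow> i \<in> S"
    if i: "i < m" for i
  proof (cases "i \<in> S")
    case True
    then have "scalar_prod (a i) ?y = b i" "scalar_prod (a i) ?y' = b i"
      using act by (auto simp: active_set_def)
    then show ?thesis using True by (simp add: algebra_simps)
  next
    case False
    then have "scalar_prod (a i) ?y < b i" "scalar_prod (a i) ?y' < b i"
      using inactive_slack[OF poly y(1) i] inactive_slack[OF poly y(2) i] act False by auto
    then have "(1 - t) * scalar_prod (a i) ?y + t * scalar_prod (a i) ?y' < b i"
      using t by (intro convex_bound_lt) auto
    then show ?thesis using False by simp
  qed
  have "S \<subseteq> {..<m}"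
    using act(1) by (auto simp: active_set_def)
  moreover have "i \<in> active_set m a b ?z \<longleftrightarrow> i < m \<and> i \<in> S" for i
    using tight[of i] scalar_prod_convex_comb[OF a yc, of i t]
    unfolding active_set_def by (cases "i < m") simp_all
  ultimately have actz: "active_set m a b ?z = S" by blast
  have "u - ?y \<in> normal_cone P ?z" "u' - ?y' \<in> normal_cone P ?z"
    using proj_eq_iff_normal[OF poly u(1) y(1)] proj_eq_iff_normal[OF poly u(2) y(2)]
      normal_cone_mono_active_set[OF poly y(1) z] normal_cone_mono_active_set[OF poly y(2) z]
      act actz by auto
  then have "smult_vec (1 - t) (u - ?y) + smult_vec t (u' - ?y') \<in> normal_cone P ?z"
    using t PC z by (intro normal_cone_convex_comb[of _ _ _ _ _ n]) auto
  moreover have "smult_vec (1 - t) (u - ?y) + smult_vec t (u' - ?y') =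
      (smult_vec (1 - t) u + smult_vec t u') - ?z"
    using u yc by (intro eq_vecI) (auto simp: algebra_simps)
  ultimately show ?eq
    using proj_eq_iff_normal[OF poly _ z] u by simp
  then show "active_set m a b (proj P (smult_vec (1 - t) u + smult_vec t u')) = S"
    using actz by simp
qed

section \<open>Intervals and affine pieces\<close>

text \<open>
  A frontier point with points of the interval strictly on both sides would be an interior point. So
  it bounds the interval from below or from above, and being a limit of its points it is the infimum
  or the supremum. If the interval is unbounded on a side, the value named for that side is an
  unspecified default; the inclusion still bounds the number of end points by two.
\<close>

lemma frontier_interval_subset:
  fixes I :: "real set"
  assumes "is_interval I"
  shows "frontier I \<subseteq> {Inf I, Sup I}"
proof
  fix y assume y: "y \<in> frontier I"
  have cl: "y \<in> closure I" and ni: "y \<notin> interior I"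
    using y by (auto simp: frontier_def)
  have ne: "I \<noteq> {}" using cl by auto
  show "y \<in> {Inf I, Sup I}"
  proof (cases "\<forall>x\<in>I. y \<le> x")
    case True
    have "z \<le> y" if "\<And>x. x \<in> I \<Longrightarrow> z \<le> x" for z
      using cl closure_minimal[of I "{z..}"] that by auto
    then have "Inf I = y" using True ne by (intro cInf_eq_non_empty) auto
    then show ?thesis by simp
  next
    case False
    then obtain x where x: "x \<in> I" "x < y" by force
    have ub: "z \<le> y" if "z \<in> I" for z
    proof (rule ccontr)
      assume "\<not> z \<le> y"
      have "{x<..<z} \<subseteq> I"
        using mem_is_interval_1_I[OF assms x(1) that] by auto
      then have "{x<..<z} \<subseteq> interior I"
        by (rule interior_maximal) simp
      moreover have "y \<in> {x<..<z}"
        using x(2) \<open>\<not> z \<le> y\<close> by simp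
      ultimately show False using ni by blast
    qed
    have "y \<le> z" if "\<And>x. x \<in> I \<Longrightarrow> x \<le> z" for z
      using cl closure_minimal[of I "{..z}"] that by auto
    then have "Sup I = y" using ub ne by (intro cSup_eq_non_empty) auto
    then show ?thesis by simp
  qed
qed

lemma affine_on_Un:
  assumes "affine_on n g J" "affine_on n g U"
    and "s \<in> J" "s \<in> U" "s' \<in> J" "s' \<in> U" "s \<noteq> s'"
  shows "affine_on n g (J \<union> U)"
proof -
  obtain p q where pq: "p \<in> carrier_vec n" "q \<in> carrier_vec n" "\<And>l. l \<in> J \<Longrightarrow> g l = p + smult_vec l q"
    using assms(1) by (auto simp: affine_on_def)
  obtain p' q' where pq': "p' \<in> carrier_vec n" "q' \<in> carrier_vec n" "\<And>l. l \<in> U \<Longrightarrow> g l = p' + smult_vec l q'"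
    using assms(2) by (auto simp: affine_on_def)
  have eq: "vec_index p i + l * vec_index q i = vec_index p' i + l * vec_index q' i"
    if "i < n" "l \<in> {s, s'}" for i l
  proof -
    have "p + smult_vec l q = p' + smult_vec l q'"
      using pq(3)[of l] pq'(3)[of l] assms that(2) by auto
    from arg_cong[OF this, of "\<lambda>v. vec_index v i"] show ?thesis
      using pq pq' that(1) by simp
  qed
  have qi: "vec_index q i = vec_index q' i" if "i < n" for i
  proof -
    have "(s - s') * (vec_index q i - vec_index q' i) = 0"
      using eq[OF that, of s] eq[OF that, of s'] by (simp add: algebra_simps)
    then show ?thesis using \<open>s \<noteq> s'\<close> by simp
  qed
  have "q = q'" "p = p'"
    using pq(1,2) pq'(1,2) qi eq[of _ s] by (auto intro!: eq_vecI)
  then show ?thesis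
    unfolding affine_on_def using pq pq' by blast
qed

text \<open>
  The interval \<open>J\<close> is not a single point, since \<open>g\<close> is not constant on it; so it meets each
  neighbourhood of its end point \<open>t\<close> in at least two points. These determine the affine function, so
  \<open>g\<close> would be affine on \<open>J \<union> {l1..l2}\<close>, against the maximality of \<open>J\<close>.
\<close>

lemma maximal_moving_interval_no_interior_break:
  assumes J: "maximal_moving_interval n g J" and t: "t \<in> frontier J"
    and aff: "affine_on n g {l1..l2}" and l: "0 \<le> l1" "l1 < t" "t < l2"
  shows False
proof -
  have iv: "is_interval J" and J0: "J \<subseteq> {0..}" and affJ: "affine_on n g J"
    and nc: "\<not> g constant_on J"
    and mx: "\<And>J'. moving_interval n g J' \<Longrightarrow> J \<subseteq> J' \<Longrightarrow> J' = J"
    using J by (auto simp: maximal_moving_interval_def moving_interval_def)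
  have cJ: "connected J" using iv by (simp add: is_interval_connected_1)
  have "t \<in> closure J" and tni: "t \<notin> interior J" using t by (auto simp: frontier_def)
  then have "{l1<..<l2} \<inter> closure J \<noteq> {}"
    using l by auto
  then have "{l1<..<l2} \<inter> J \<noteq> {}"
    by (simp only: open_Int_closure_eq_empty[OF open_greaterThanLessThan] not_False_eq_True)
  then obtain s where s: "s \<in> J" "s \<in> {l1<..<l2}" by blast
  have "J \<noteq> {x}" for x using nc by (auto simp: constant_on_def)
  with cJ s(1) have "s islimpt J" by (rule connected_imp_perfect)
  then obtain s' where s': "s' \<in> J" "s' \<in> {l1<..<l2}" "s' \<noteq> s"
    using s(2) unfolding islimpt_def by (meson open_greaterThanLessThan)
  let ?J' = "J \<union> {l1..l2}"
  have "connected ?J'"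
    using cJ s by (intro connected_Un) auto
  moreover have "affine_on n g ?J'"
    using affine_on_Un[OF affJ aff, of s s'] s s' by auto
  moreover have "\<not> g constant_on ?J'"
    using nc constant_on_subset[of g ?J' J] by blast
  ultimately have "moving_interval n g ?J'"
    using J0 l by (auto simp: moving_interval_def is_interval_connected_1)
  then have "?J' = J" by (rule mx) auto
  then have "{l1..l2} \<subseteq> J" by blast
  then have "{l1<..<l2} \<subseteq> J" using greaterThanLessThan_subseteq_atLeastAtMost_iff by blast
  then show False
    using tni l interior_maximal[of "{l1<..<l2}" J] by auto
qed

lemma affine_on_segment:
  fixes g :: "real \<Rightarrow> real Matrix.vec"
  assumes "l1 < l2" "g l1 \<in> carrier_vec n" "g l2 \<in> carrier_vec n"
    and conv: "\<And>t. 0 \<le> t \<Longrightarrow> t \<le> 1 \<Longrightarrow>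
      g ((1 - t) * l1 + t * l2) = smult_vec (1 - t) (g l1) + smult_vec t (g l2)"
  shows "affine_on n g {l1..l2}"
proof -
  define q where "q = smult_vec (1 / (l2 - l1)) (g l2 - g l1)"
  define p where "p = g l1 - smult_vec l1 q"
  have c: "q \<in> carrier_vec n" "p \<in> carrier_vec n"
    using assms by (auto simp: q_def p_def)
  have "g l = p + smult_vec l q" if l: "l \<in> {l1..l2}" for l
  proof -
    define t where "t = (l - l1) / (l2 - l1)"
    have t: "0 \<le> t" "t \<le> 1" using l assms(1) by (auto simp: t_def)
    have "t * (l2 - l1) = l - l1" using assms(1) by (simp add: t_def)
    then have "(1 - t) * l1 + t * l2 = l" by (simp add: algebra_simps)
    then have "g l = smult_vec (1 - t) (g l1) + smult_vec t (g l2)"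
      using conv[OF t] by simp
    also have "\<dots> = g l1 + smult_vec t (g l2 - g l1)"
      by (rule vec_eq_add_smult_diff[OF assms(2,3), symmetric])
    also have "\<dots> = g l1 + smult_vec (l - l1) q"
      by (simp add: q_def t_def smult_smult_assoc)
    also have "\<dots> = p + smult_vec l q"
      using c assms(2) by (intro eq_vecI) (auto simp: p_def algebra_simps)
    finally show ?thesis .
  qed
  then show ?thesis unfolding affine_on_def using c by blast
qed

section \<open>Counting breakpoints\<close>

text \<open>
  The map \<open>\<sigma>\<close> stands for any labelling of the parameters such that \<open>g\<close> is affine between two
  parameters with the same label; for the projections curve it is the set of tight constraints. Since
  all classes lie in \<open>{0..}\<close>, the parameter \<open>0\<close> is a frontier point of its own class, so a
  breakpoint at \<open>0\<close> is covered as well.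
\<close>

lemma breakpoints_subset_frontiers:
  fixes \<sigma> :: "real \<Rightarrow> 'a"
  assumes seg: "\<And>l1 l2. 0 \<le> l1 \<Longrightarrow> l1 < l2 \<Longrightarrow> \<sigma> l1 = \<sigma> l2 \<Longrightarrow> affine_on n g {l1..l2}"
  shows "breakpoints n g \<subseteq> (\<Union>S\<in>\<sigma> ` {0..}. frontier {l. 0 \<le> l \<and> \<sigma> l = S})"
proof
  fix t assume "t \<in> breakpoints n g"
  then obtain J where J: "maximal_moving_interval n g J" "t \<in> frontier J"
    by (auto simp: breakpoints_def)
  have "J \<subseteq> {0..}"
    using J(1) by (simp add: maximal_moving_interval_def moving_interval_def)
  then have t0: "0 \<le> t"
    using J(2) closure_minimal[of J "{0..}"] by (auto simp: frontier_def)
  let ?L = "{l. 0 \<le> l \<and> \<sigma> l = \<sigma> t}"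
  have "t \<in> frontier ?L"
  proof (rule ccontr)
    assume "t \<notin> frontier ?L"
    moreover have "t \<in> ?L" using t0 by simp
    ultimately have "t \<in> interior ?L"
      using closure_subset[of ?L] by (auto simp: frontier_def)
    then obtain e where e: "e > 0" "cball t e \<subseteq> ?L"
      unfolding mem_interior_cball by blast
    moreover have "t - e \<in> cball t e" "t + e \<in> cball t e"
      using e(1) by (simp_all add: dist_real_def)
    ultimately have "t - e \<in> ?L" "t + e \<in> ?L" by blast+
    then have "affine_on n g {t - e..t + e}" "0 \<le> t - e"
      using e(1) by (simp_all add: seg)
    then show False
      using maximal_moving_interval_no_interior_break[OF J, of "t - e" "t + e"] e(1) by simp
  qed
  then show "t \<in> (\<Union>S\<in>\<sigma> ` {0..}. frontier {l. 0 \<le> l \<and> \<sigma> l = S})"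
    using t0 by auto
qed

lemma card_breakpoints_le:
  fixes \<sigma> :: "real \<Rightarrow> 'a"
  assumes seg: "\<And>l1 l2. 0 \<le> l1 \<Longrightarrow> l1 < l2 \<Longrightarrow> \<sigma> l1 = \<sigma> l2 \<Longrightarrow> affine_on n g {l1..l2}"
    and iv: "\<And>S. is_interval {l. 0 \<le> l \<and> \<sigma> l = S}"
    and T: "\<sigma> ` {0..} \<subseteq> T" "finite T"
  shows "finite (breakpoints n g) \<and> card (breakpoints n g) \<le> 2 * card T"
proof -
  define E where "E S = {Inf {l. 0 \<le> l \<and> \<sigma> l = S}, Sup {l. 0 \<le> l \<and> \<sigma> l = S}}" for S
  have sub: "breakpoints n g \<subseteq> (\<Union>S\<in>T. E S)"
    using breakpoints_subset_frontiers[of \<sigma> n g, OF seg] frontier_interval_subset[OF iv] T(1)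
    unfolding E_def by blast
  have fin: "finite (\<Union>S\<in>T. E S)"
    using T(2) by (auto simp: E_def)
  have "card (\<Union>S\<in>T. E S) \<le> (\<Sum>S\<in>T. card (E S))"
    by (rule card_UN_le[OF T(2)])
  also have "\<dots> \<le> (\<Sum>S\<in>T. 2)"
    by (intro sum_mono) (simp add: E_def card_insert_if)
  finally have "card (\<Union>S\<in>T. E S) \<le> 2 * card T" by simp
  then show ?thesis
    using sub fin by (meson card_mono finite_subset order_trans)
qed

lemma card_breakpoints_proj_curve_le:
  assumes poly: "is_polytope_of n m a b P" and x0: "x0 \<in> P" and w: "w \<in> carrier_vec n"
  shows "finite (breakpoints n (proj_curve P x0 w)) \<and>
    card (breakpoints n (proj_curve P x0 w)) \<le> 2 * 2 ^ m"
proof -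
  define g where "g = proj_curve P x0 w"
  define \<sigma> where "\<sigma> l = active_set m a b (g l)" for l
  have PC: "P \<subseteq> carrier_vec n"
    using poly by (auto simp: is_polytope_of_def polyhedron_of_def)
  have uc: "x0 - smult_vec l w \<in> carrier_vec n" for l using x0 PC w by auto
  have gc: "g l \<in> carrier_vec n" for l
    using proj_mem[OF poly uc] x0 PC unfolding g_def proj_curve_def by blast
  have comb: "g ((1 - t) * l1 + t * l2) = smult_vec (1 - t) (g l1) + smult_vec t (g l2)"
      "\<sigma> ((1 - t) * l1 + t * l2) = S"
    if "\<sigma> l1 = S" "\<sigma> l2 = S" "0 \<le> t" "t \<le> 1" for l1 l2 t S
  proof -
    have u: "x0 - smult_vec ((1 - t) * l1 + t * l2) w =
        smult_vec (1 - t) (x0 - smult_vec l1 w) + smult_vec t (x0 - smult_vec l2 w)"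
      using x0 PC w by (intro eq_vecI) (auto simp: algebra_simps)
    have "P \<noteq> {}" using x0 by auto
    note c = proj_convex_comb[OF poly this uc uc, of l1 S l2 t]
    show "g ((1 - t) * l1 + t * l2) = smult_vec (1 - t) (g l1) + smult_vec t (g l2)"
      "\<sigma> ((1 - t) * l1 + t * l2) = S"
      using c that unfolding \<sigma>_def g_def proj_curve_def u by blast+
  qed
  have "affine_on n g {l1..l2}" if "l1 < l2" "\<sigma> l1 = \<sigma> l2" for l1 l2
    using comb(1)[OF that(2) refl] by (intro affine_on_segment that gc)
  moreover have "is_interval {l. 0 \<le> l \<and> \<sigma> l = S}" for S
  proof -
    have "convex {l. 0 \<le> l \<and> \<sigma> l = S}"
      unfolding convex_alt using comb(2) by auto
    then show ?thesis by (simp add: is_interval_convex_1)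
  qed
  moreover have "\<sigma> ` {0..} \<subseteq> Pow {..<m}"
    by (auto simp: \<sigma>_def active_set_def)
  ultimately have "finite (breakpoints n g) \<and> card (breakpoints n g) \<le> 2 * card (Pow {..<m})"
    by (intro card_breakpoints_le[of \<sigma>]) auto
  then show ?thesis by (simp add: g_def card_Pow)
qed

theorem theorem4:
  shows "\<exists>C::real. \<forall>(n::nat) (m::nat) (a :: nat \<Rightarrow> real Matrix.vec) (b :: nat \<Rightarrow> real) P.
    is_polytope_of n m a b P \<longrightarrow>
    (\<forall>x0\<in>P. \<forall>w\<in>carrier_vec n.
       finite (breakpoints n (proj_curve P x0 w)) \<and>
       real (card (breakpoints n (proj_curve P x0 w))) \<le> C * 2 ^ m)"
proof (intro exI[of _ 2] allI impI ballI)
  fix n m :: nat and a :: "nat \<Rightarrow> real Matrix.vec" and b :: "nat \<Rightarrow> real"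
    and P and x0 w :: "real Matrix.vec"
  assume "is_polytope_of n m a b P" "x0 \<in> P" "w \<in> carrier_vec n"
  note bound = card_breakpoints_proj_curve_le[OF this]
  have "real (card (breakpoints n (proj_curve P x0 w))) \<le> real (2 * 2 ^ m)"
    by (rule of_nat_mono[OF conjunct2[OF bound]])
  also have "\<dots> = 2 * 2 ^ m" by simp
  finally show "finite (breakpoints n (proj_curve P x0 w)) \<and>
      real (card (breakpoints n (proj_curve P x0 w))) \<le> 2 * 2 ^ m"
    by (rule conjI[OF conjunct1[OF bound]])
qed

end
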